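(* Consider the process $\{\hat{\mathcal N}(t),\,t>0\}$ with $\hat{\mathcal N}(t)=N_1(\mathcal N_2(t))$, where $\{N_1(t),\,t\ge0\}$ is a Poisson process with parameter $\nu>0$ and $\{\mathcal N_2(t),\,t\ge0\}$ is a nonhomogeneous Poisson process with parameter $\lambda(t)$, $t>0$, the two processes being independent. Then $\{\hat{\mathcal N}(t),\,t>0\}$ is a nonhomogeneous Bell-Touchard process with parameters $\alpha:=m(t)e^{-\nu}$ and $\theta:=\nu$, where $m(t):=\int_0^t\lambda(s)\,ds$.
   Context: $\mathbb{N}=\{1,2,\dots\}$, $\mathbb{N}_0=\mathbb{N}\cup\{0\}$. A counting process is a stochastic process $\{N(t),\,t\ge0\}$ where $N(t)\in\mathbb{N}_0$ represents the number of events that occur within a time interval of length $t$, namely $[0,t)$. A function $f:\mathbb{R}\to\mathbb{R}$ is $o(s)$ if $\lim_{s\to0}f(s)/s=0$. A counting process $\{N(t),\,t\ge0\}$ is a nonhomogeneous Bell-Touchard process with parameters $(\alpha(t),\theta)$, where $\alpha(t):\mathbb{R}\to\mathbb{R}_+$, if (1) $N(0)=0$; (2) it has independent increments; (3) $\Pr[N(t+s)-N(t)=k]=\alpha(t)s\,\theta^k/k!+o(s)$, for $k\in\mathbb{N}$ and $s,t>0$. A nonhomogeneous Poisson process with parameter (rate function) $\lambda(t)$ is, in the usual sense, a counting process starting at $0$ with independent increments whose value at time $t$ has the Poisson distribution with mean $\int_0^t\lambda(s)\,ds$.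
   Formalization: Condition (3) fails with α(t)=m(t)e^{-ν} (e.g. λ=1, t≠1); proved instead with α(t)=λ(t)e^{-ν}, λ assumed right-continuous for t>0, plus: the value at each t>0 has the Bell-Touchard distribution with parameters m(t)e^{-ν} and ν. *)

theory Defs
  imports
    "HOL-Probability.Probability"
    "HOL-Library.Landau_Symbols"
    "HOL-Combinatorics.Stirling"
begin

text \<open>
  Processes are families of random variables indexed by real numbers, of which only the times
  \<open>t \<ge> 0\<close> matter. The paths of a counting process count the events in \<open>[0, t)\<close>, so they are
  nondecreasing; exceptional null sets are allowed for the path properties.
\<close>

definition counting_process :: "'a measure \<Rightarrow> (real \<Rightarrow> 'a \<Rightarrow> nat) \<Rightarrow> bool" where
  "counting_process M N \<longleftrightarrow>
     prob_space M \<and>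
     (\<forall>t\<ge>0. N t \<in> M \<rightarrow>\<^sub>M count_space UNIV) \<and>
     (AE \<omega> in M. \<forall>s t. 0 \<le> s \<and> s \<le> t \<longrightarrow> N s \<omega> \<le> N t \<omega>)"

text \<open>Increments are taken in the integers to avoid truncated subtraction.\<close>

definition increment :: "(real \<Rightarrow> 'a \<Rightarrow> nat) \<Rightarrow> real \<Rightarrow> real \<Rightarrow> 'a \<Rightarrow> int" where
  "increment N s t \<omega> = int (N t \<omega>) - int (N s \<omega>)"

definition independent_increments :: "'a measure \<Rightarrow> (real \<Rightarrow> 'a \<Rightarrow> nat) \<Rightarrow> bool" where
  "independent_increments M N \<longleftrightarrow>
     (\<forall>n. \<forall>\<tau> :: nat \<Rightarrow> real. 0 \<le> \<tau> 0 \<and> (\<forall>i<n. \<tau> i < \<tau> (Suc i)) \<longrightarrow>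
        prob_space.indep_vars M (\<lambda>_. count_space UNIV)
          (\<lambda>i. increment N (\<tau> i) (\<tau> (Suc i))) {..<n})"

definition nonhomogeneous_bell_touchard_process ::
    "'a measure \<Rightarrow> (real \<Rightarrow> 'a \<Rightarrow> nat) \<Rightarrow> (real \<Rightarrow> real) \<Rightarrow> real \<Rightarrow> bool" where
  "nonhomogeneous_bell_touchard_process M N \<alpha> \<theta> \<longleftrightarrow>
     counting_process M N \<and>
     (\<forall>t>0. 0 \<le> \<alpha> t) \<and>
     (AE \<omega> in M. N 0 \<omega> = 0) \<and>
     independent_increments M N \<and>
     (\<forall>k\<ge>1. \<forall>t>0.
        (\<lambda>s. measure M {\<omega> \<in> space M. increment N t (t + s) \<omega> = int k} - \<alpha> t * s * \<theta> ^ k / fact k)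
          \<in> o[at_right 0](\<lambda>s. s))"

definition mean_function :: "(real \<Rightarrow> real) \<Rightarrow> real \<Rightarrow> real" where
  "mean_function rate t = (LINT s:{0<..t}|lborel. rate s)"

text \<open>
  The Poisson mass function is written out because \<^const>\<open>poisson_pmf\<close> needs a positive mean,
  whereas here the mean may vanish (always at \<open>t = 0\<close>).
\<close>

definition nonhomogeneous_poisson_process ::
    "'a measure \<Rightarrow> (real \<Rightarrow> 'a \<Rightarrow> nat) \<Rightarrow> (real \<Rightarrow> real) \<Rightarrow> bool" where
  "nonhomogeneous_poisson_process M N rate \<longleftrightarrow>
     counting_process M N \<and>
     (\<forall>t>0. 0 \<le> rate t) \<and>
     (\<forall>t>0. set_integrable lborel {0<..t} rate) \<and>
     (AE \<omega> in M. N 0 \<omega> = 0) \<and>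
     independent_increments M N \<and>
     (\<forall>t\<ge>0. \<forall>n. measure M {\<omega> \<in> space M. N t \<omega> = n} =
        mean_function rate t ^ n / fact n * exp (- mean_function rate t))"

definition poisson_process :: "'a measure \<Rightarrow> (real \<Rightarrow> 'a \<Rightarrow> nat) \<Rightarrow> real \<Rightarrow> bool" where
  "poisson_process M N \<nu> \<longleftrightarrow> nonhomogeneous_poisson_process M N (\<lambda>_. \<nu>)"

text \<open>Independence of the two sigma-algebras generated by the whole processes.\<close>

definition independent_processes ::
    "'a measure \<Rightarrow> (real \<Rightarrow> 'a \<Rightarrow> nat) \<Rightarrow> (real \<Rightarrow> 'a \<Rightarrow> nat) \<Rightarrow> bool" where
  "independent_processes M X Y \<longleftrightarrow>
     prob_space.indep_var M
       (Pi\<^sub>M {0..} (\<lambda>_. count_space UNIV)) (\<lambda>\<omega>. \<lambda>t\<in>{0..}. X t \<omega>)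
       (Pi\<^sub>M {0..} (\<lambda>_. count_space UNIV)) (\<lambda>\<omega>. \<lambda>t\<in>{0..}. Y t \<omega>)"

text \<open>
  The Bell-Touchard distribution, with generating function \<open>z \<mapsto> exp (a (exp (\<theta> z) - exp \<theta>))\<close>;
  the sum is the Touchard polynomial of degree \<open>n\<close> at \<open>a\<close>. For a nonhomogeneous Bell-Touchard
  process at time \<open>t\<close>, the parameter \<open>a\<close> is the integral of \<open>\<alpha>\<close> over \<open>[0, t]\<close>, not the
  value \<open>\<alpha> t\<close>.
\<close>

definition bell_touchard_mass :: "real \<Rightarrow> real \<Rightarrow> nat \<Rightarrow> real" where
  "bell_touchard_mass a \<theta> n =
     exp (- a * (exp \<theta> - 1)) * \<theta> ^ n / fact n * (\<Sum>k\<le>n. real (Stirling n k) * a ^ k)"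

end

theory Submission
  imports Defs
begin

text \<open>
  Write \<open>m\<close> for the mean function of \<open>N2\<close>. Given the path of \<open>N2\<close>, the increment of \<open>Nhat\<close> over an
  interval is an increment of \<open>N1\<close> between two fixed integer times, whose distance is the
  increment \<open>D\<close> of \<open>N2\<close> over the same interval. So its conditional law is Poisson with mean
  \<open>\<nu> * D\<close>, a function of \<open>D\<close> alone, and over several disjoint intervals the conditional laws
  multiply. Since the increments of \<open>N2\<close> are independent, so are those of \<open>Nhat\<close>
  (\<open>Nhat_increments_prob\<close>, \<open>Nhat_independent_increments\<close>).

  The increment of \<open>N2\<close> over \<open>(s, t]\<close> is Poisson with mean \<open>m t - m s\<close>
  (\<open>nonhomogeneous_poisson_process_increment\<close>), so the increment of \<open>Nhat\<close> is a Poisson mixture of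
  Poisson laws. By Dobinski's formula this is the Bell-Touchard law with parameters
  \<open>(m t - m s) * exp (- \<nu>)\<close> and \<open>\<nu>\<close> (\<open>poisson_mixture_sums_bell_touchard\<close>, \<open>Nhat_increment_mass\<close>).
  With \<open>s = 0\<close> this is the law of \<open>Nhat t\<close>.

  The infinitesimal rates follow from the same explicit law: the mass at \<open>k \<ge> 1\<close> vanishes when the
  first parameter is \<open>0\<close> and has derivative \<open>\<nu> ^ k / fact k\<close> there (\<open>bell_touchard_mass_deriv_0\<close>), while
  \<open>m\<close> has the right derivative \<open>rate t\<close> (\<open>mean_function_right_derivative\<close>). By the chain rule the
  probability of \<open>k\<close> events in \<open>(t, t + s]\<close> is \<open>rate t * exp (- \<nu>) * s * \<nu> ^ k / fact k + o(s)\<close>.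
\<close>

section \<open>Poisson masses and Dobinski's formula\<close>

text \<open>
  The mean may be \<open>0\<close>, in which case \<open>0 ^ 0 = 1\<close> yields the point mass at \<open>0\<close>, the law of an
  increment whose mean vanishes.
\<close>
definition poisson_mass :: "real \<Rightarrow> nat \<Rightarrow> real" where
  "poisson_mass a n = a ^ n / fact n * exp (- a)"

lemma poisson_mass_convolution:
  "(\<Sum>i\<le>n. poisson_mass a i * poisson_mass b (n - i)) = poisson_mass (a + b) n"
proof -
  have "(\<Sum>i\<le>n. poisson_mass a i * poisson_mass b (n - i))
      = (\<Sum>i\<le>n. real (n choose i) * a ^ i * b ^ (n - i) / fact n * exp (- (a + b)))"
    by (rule sum.cong) (auto simp: poisson_mass_def binomial_fact exp_add exp_diff exp_minus field_simps)
  also have "\<dots> = poisson_mass (a + b) n"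
    by (simp add: poisson_mass_def binomial_ring sum_distrib_right sum_divide_distrib)
  finally show ?thesis .
qed

text \<open>
  Convolution with a sequence that does not start with zero is injective, so the law of a summand
  can be recovered from the law of an independent sum. This is how the law of an increment
  \<open>N t - N s\<close> is obtained from the laws of \<open>N s\<close> and \<open>N t\<close>.
\<close>
lemma convolution_cancel:
  fixes p f g :: "nat \<Rightarrow> real"
  assumes "p 0 \<noteq> 0"
    and eq: "\<And>n. (\<Sum>i\<le>n. p i * f (n - i)) = (\<Sum>i\<le>n. p i * g (n - i))"
  shows "f n = g n"
proof (induction n rule: less_induct)
  case (less n)
  have split: "(\<Sum>i\<le>n. p i * h (n - i)) = p 0 * h n + (\<Sum>i\<in>{1..n}. p i * h (n - i))"
    for h :: "nat \<Rightarrow> real"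
    by (simp add: atMost_atLeast0 sum.atLeast_Suc_atMost)
  have "(\<Sum>i\<in>{1..n}. p i * f (n - i)) = (\<Sum>i\<in>{1..n}. p i * g (n - i))"
    by (rule sum.cong) (auto simp: less)
  with eq[of n] \<open>p 0 \<noteq> 0\<close> show ?case
    by (simp add: split)
qed

text \<open>
  The factor \<open>fact k * (j choose k)\<close> is the falling factorial \<open>j (j - 1) \<dots> (j - k + 1)\<close>. Multiplying
  it by \<open>j = (j - k) + k\<close> gives the next falling factorial plus \<open>k\<close> times the same one, which is
  the recurrence of the Stirling numbers of the second kind.
\<close>
lemma power_eq_Stirling_sum:
  "real j ^ n = (\<Sum>k\<le>n. real (Stirling n k) * (fact k * real (j choose k)))"
proof (induction n)
  case (Suc n)
  define ff :: "nat \<Rightarrow> real" where "ff k = fact k * real (j choose k)" for k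
  have step: "real j * ff k = ff (Suc k) + real k * ff k" for k
  proof (cases "k \<le> j")
    case True
    have "Suc k * (j choose Suc k) = (j - k) * (j choose k)"
      using binomial_absorb_comp[of j k] binomial_absorption[of k j]
      by (metis True binomial_absorb_comp binomial_absorption)
    hence "real (Suc k) * real (j choose Suc k) = (real j - real k) * real (j choose k)"
      using True by (metis of_nat_diff of_nat_mult)
    hence "fact k * (real (Suc k) * real (j choose Suc k)) = fact k * ((real j - real k) * real (j choose k))"
      by simp
    thus ?thesis by (simp add: ff_def algebra_simps)
  qed (simp add: ff_def binomial_eq_0)
  have "real j ^ Suc n = (\<Sum>k\<le>n. real (Stirling n k) * (real j * ff k))"
    by (simp add: Suc ff_def sum_distrib_left algebra_simps)
  also have "\<dots> = (\<Sum>k\<le>n. real (Stirling n k) * ff (Suc k)) + (\<Sum>k\<le>n. real k * real (Stirling n k) * ff k)"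
    by (simp add: step sum.distrib algebra_simps)
  also have "(\<Sum>k\<le>n. real k * real (Stirling n k) * ff k)
      = (\<Sum>k\<le>Suc n. real k * real (Stirling n k) * ff k)"
    by simp
  also have "\<dots> = (\<Sum>k\<le>n. real (Suc k) * real (Stirling n (Suc k)) * ff (Suc k))"
    by (subst sum.atMost_Suc_shift) simp
  also have "(\<Sum>k\<le>n. real (Stirling n k) * ff (Suc k)) + \<dots>
      = (\<Sum>k\<le>n. real (Stirling (Suc n) (Suc k)) * ff (Suc k))"
    by (simp add: sum.distrib algebra_simps)
  also have "\<dots> = (\<Sum>k\<le>Suc n. real (Stirling (Suc n) k) * ff k)"
    by (subst sum.atMost_Suc_shift) simp
  finally show ?case by (simp add: ff_def)
qed simp

text \<open>
  Dobinski's formula for Touchard polynomials: the \<open>n\<close>-th moment of an unnormalized Poisson law.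
  Falling factorials are the convenient basis because their Poisson moments are the
  powers \<open>a ^ k\<close>.
\<close>
lemma Dobinski_sums:
  fixes a :: real
  shows "(\<lambda>j. a ^ j / fact j * real j ^ n) sums (exp a * (\<Sum>k\<le>n. real (Stirling n k) * a ^ k))"
proof -
  have *: "(\<lambda>j. a ^ j / fact j * (fact k * real (j choose k))) sums (exp a * a ^ k)" for k
  proof -
    have "(\<lambda>i. a ^ k * (a ^ i / fact i)) sums (a ^ k * exp a)"
      using exp_converges[of a]
      by (intro sums_mult) (simp add: scaleR_conv_of_real divide_inverse mult.commute)
    also have "(\<lambda>i. a ^ k * (a ^ i / fact i))
        = (\<lambda>i. a ^ (i + k) / fact (i + k) * (fact k * real ((i + k) choose k)))"
      by (rule ext) (simp add: binomial_fact power_add)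
    finally have "(\<lambda>j. a ^ j / fact j * (fact k * real (j choose k))) sums
        (a ^ k * exp a + (\<Sum>i<k. a ^ i / fact i * (fact k * real (i choose k))))"
      by (subst (asm) sums_iff_shift)
    moreover have "(\<Sum>i<k. a ^ i / fact i * (fact k * real (i choose k))) = 0"
      by (rule sum.neutral) auto
    ultimately show ?thesis by (simp add: mult.commute)
  qed
  have "(\<lambda>j. \<Sum>k\<le>n. real (Stirling n k) * (a ^ j / fact j * (fact k * real (j choose k))))
      sums (\<Sum>k\<le>n. real (Stirling n k) * (exp a * a ^ k))"
    by (intro sums_sum sums_mult *)
  thus ?thesis
    by (simp add: power_eq_Stirling_sum sum_distrib_left algebra_simps)
qed

text \<open>
  A Poisson variable whose mean is \<open>\<nu>\<close> times another Poisson variable of mean \<open>m\<close>. Collecting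
  \<open>m ^ j * exp (- \<nu> * j)\<close> into the power \<open>(m * exp (- \<nu>)) ^ j\<close> turns the mixture into the series of
  Dobinski's formula.
\<close>
lemma poisson_mixture_sums_bell_touchard:
  "(\<lambda>j. poisson_mass m j * poisson_mass (\<nu> * real j) n) sums
     bell_touchard_mass (m * exp (- \<nu>)) \<nu> n"
proof -
  define a where "a = m * exp (- \<nu>)"
  have m: "m = a * exp \<nu>" by (simp add: a_def exp_minus)
  have "(\<lambda>j. \<nu> ^ n / fact n * exp (- m) * (a ^ j / fact j * real j ^ n)) sums
      (\<nu> ^ n / fact n * exp (- m) * (exp a * (\<Sum>k\<le>n. real (Stirling n k) * a ^ k)))"
    by (intro sums_mult Dobinski_sums)
  also have "(\<lambda>j. \<nu> ^ n / fact n * exp (- m) * (a ^ j / fact j * real j ^ n))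
      = (\<lambda>j. poisson_mass m j * poisson_mass (\<nu> * real j) n)"
    by (rule ext) (simp add: poisson_mass_def a_def power_mult_distrib exp_minus
        exp_of_nat2_mult field_simps)
  also have "\<nu> ^ n / fact n * exp (- m) * (exp a * (\<Sum>k\<le>n. real (Stirling n k) * a ^ k))
      = bell_touchard_mass a \<nu> n"
    by (simp add: bell_touchard_mass_def m exp_minus exp_diff field_simps)
  finally show ?thesis by (simp add: a_def)
qed

text \<open>
  For \<open>n \<ge> 1\<close> the Touchard polynomial has no constant term and linear coefficient
  \<open>Stirling n 1 = 1\<close>, so near \<open>a = 0\<close> the mass at \<open>n\<close> is \<open>a * \<theta> ^ n / fact n\<close> to first order. This is
  where the shape of the Bell-Touchard rates comes from.
\<close>
lemma bell_touchard_mass_deriv_0: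
  assumes "n \<ge> 1"
  shows "((\<lambda>a. bell_touchard_mass a \<theta> n) has_real_derivative \<theta> ^ n / fact n) (at 0)"
proof -
  obtain l where n: "n = Suc l" using assms by (cases n) auto
  define S where "S a = (\<Sum>k\<le>n. real (Stirling n k) * a ^ k)" for a :: real
  have S0: "S 0 = 0" by (simp add: S_def n sum.atMost_Suc_shift)
  have "(S has_real_derivative (\<Sum>k\<le>n. real (Stirling n k) * (real k * 0 ^ (k - 1)))) (at 0)"
    unfolding S_def by (auto intro!: derivative_eq_intros sum.cong)
  also have "(\<Sum>k\<le>n. real (Stirling n k) * (real k * 0 ^ (k - 1)))
      = (\<Sum>k\<in>{1}. real (Stirling n k) * (real k * 0 ^ (k - 1)))"
    using assms by (intro sum.mono_neutral_right) auto
  also have "\<dots> = 1" by (simp add: n del: Stirling.simps)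
  finally have S': "(S has_real_derivative 1) (at 0)" .
  have "((\<lambda>a. exp (- a * (exp \<theta> - 1)) * \<theta> ^ n / fact n * S a)
      has_real_derivative \<theta> ^ n / fact n) (at 0)"
    by (rule derivative_eq_intros S' refl | simp add: S0)+
  thus ?thesis by (simp add: bell_touchard_mass_def S_def)
qed

section \<open>Discrete random variables\<close>

lemma (in prob_space) discrete_expectation_sums:
  fixes X :: "'a \<Rightarrow> nat" and g :: "nat \<Rightarrow> real"
  assumes [measurable]: "X \<in> M \<rightarrow>\<^sub>M count_space UNIV" and g: "\<And>j. \<bar>g j\<bar> \<le> B"
  shows "(\<lambda>j. prob {\<omega> \<in> space M. X \<omega> = j} * g j) sums expectation (\<lambda>\<omega>. g (X \<omega>))"
proof -
  let ?f = "\<lambda>j \<omega>. indicator {\<omega> \<in> space M. X \<omega> = j} \<omega> * g j"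
  have int: "integrable M (?f j)" for j
    by (intro integrable_mult_left integrable_real_indicator) (auto simp: emeasure_eq_measure)
  have val: "expectation (\<lambda>\<omega>. indicator {\<omega> \<in> space M. X \<omega> = j} \<omega> * c) = prob {\<omega> \<in> space M. X \<omega> = j} * c"
    for j and c :: real
    by simp
  have "(\<lambda>j. prob {\<omega> \<in> space M. X \<omega> = j}) sums prob (\<Union>j. {\<omega> \<in> space M. X \<omega> = j})"
    by (rule finite_measure_UNION) (auto simp: disjoint_family_on_def)
  hence "summable (\<lambda>j. prob {\<omega> \<in> space M. X \<omega> = j} * B)"
    by (intro summable_mult2) (auto simp: summable_def)
  hence sm: "summable (\<lambda>j. expectation (\<lambda>\<omega>. norm (?f j \<omega>)))"
    by (rule summable_comparison_test[rotated])
       (auto simp: abs_mult val g intro!: exI[of _ 0] mult_left_mono)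
  have fin: "?f j \<omega> = 0" if "j \<notin> {X \<omega>}" for j \<omega> using that by auto
  have "summable (\<lambda>j. norm (?f j \<omega>))" for \<omega>
    by (rule summable_finite[of "{X \<omega>}"]) (use fin in auto)
  hence "(\<lambda>j. expectation (?f j)) sums expectation (\<lambda>\<omega>. \<Sum>j. ?f j \<omega>)"
    by (intro sums_integral int sm) auto
  also have "expectation (\<lambda>\<omega>. \<Sum>j. ?f j \<omega>) = expectation (\<lambda>\<omega>. g (X \<omega>))"
  proof (rule Bochner_Integration.integral_cong)
    fix \<omega> assume "\<omega> \<in> space M"
    have "(\<Sum>j. ?f j \<omega>) = (\<Sum>j\<in>{X \<omega>}. ?f j \<omega>)"
      by (rule suminf_finite) auto
    thus "(\<Sum>j. ?f j \<omega>) = g (X \<omega>)" using \<open>\<omega> \<in> space M\<close> by simp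
  qed simp
  finally show ?thesis by (simp add: val)
qed

text \<open>
  Conditioning on a countably valued variable: if each event \<open>E v\<close> is independent of \<open>V = v\<close>, then
  the index may be frozen when the probability is computed, and averaged afterwards. Enumerating
  the values of \<open>V\<close> by natural numbers reduces both sides to the same series.
\<close>
lemma (in prob_space) prob_random_event:
  fixes V :: "'a \<Rightarrow> 'b :: countable"
  assumes [measurable]: "V \<in> M \<rightarrow>\<^sub>M count_space UNIV" and E: "\<And>v. E v \<in> events"
    and indep: "\<And>v. prob {\<omega> \<in> space M. V \<omega> = v \<and> \<omega> \<in> E v} = prob {\<omega> \<in> space M. V \<omega> = v} * prob (E v)"
  shows "prob {\<omega> \<in> space M. \<omega> \<in> E (V \<omega>)} = expectation (\<lambda>\<omega>. prob (E (V \<omega>)))"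
proof -
  define X where "X \<omega> = to_nat (V \<omega>)" for \<omega>
  define E' where "E' j = E (from_nat j)" for j
  have [measurable]: "X \<in> M \<rightarrow>\<^sub>M count_space UNIV" unfolding X_def by measurable
  have [measurable]: "E' j \<in> events" for j by (simp add: E'_def E)
  have single: "prob {\<omega> \<in> space M. X \<omega> = j \<and> \<omega> \<in> E' j}
      = prob {\<omega> \<in> space M. X \<omega> = j} * prob (E' j)" for j
  proof (cases "j \<in> range (to_nat :: 'b \<Rightarrow> nat)")
    case True
    then obtain v :: 'b where v: "j = to_nat v" by auto
    have "X \<omega> = j \<longleftrightarrow> V \<omega> = v" for \<omega> by (simp add: X_def v)
    thus ?thesis using indep[of v] by (simp add: E'_def v)
  next
    case False
    hence "X \<omega> \<noteq> j" for \<omega> by (auto simp: X_def)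
    thus ?thesis by simp
  qed
  have "(\<lambda>j. prob {\<omega> \<in> space M. X \<omega> = j \<and> \<omega> \<in> E' j})
      sums prob (\<Union>j. {\<omega> \<in> space M. X \<omega> = j \<and> \<omega> \<in> E' j})"
    by (rule finite_measure_UNION) (auto simp: disjoint_family_on_def)
  also have "(\<Union>j. {\<omega> \<in> space M. X \<omega> = j \<and> \<omega> \<in> E' j}) = {\<omega> \<in> space M. \<omega> \<in> E (V \<omega>)}"
    by (auto simp: X_def E'_def)
  finally have "(\<lambda>j. prob {\<omega> \<in> space M. X \<omega> = j} * prob (E' j)) sums
      prob {\<omega> \<in> space M. \<omega> \<in> E (V \<omega>)}"
    by (simp add: single)
  moreover have "(\<lambda>j. prob {\<omega> \<in> space M. X \<omega> = j} * prob (E' j)) sums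
      expectation (\<lambda>\<omega>. prob (E' (X \<omega>)))"
    by (rule discrete_expectation_sums[where B = 1]) auto
  ultimately show ?thesis
    by (auto simp: E'_def X_def dest: sums_unique2)
qed

text \<open>
  Increments are integers and nonnegative only outside a null set, so their laws are given
  by the masses at natural numbers.
\<close>
lemma (in prob_space) nonneg_int_expectation_sums:
  fixes X :: "'a \<Rightarrow> int" and g :: "int \<Rightarrow> real"
  assumes [measurable]: "X \<in> M \<rightarrow>\<^sub>M count_space UNIV" and nonneg: "AE \<omega> in M. 0 \<le> X \<omega>"
    and g: "\<And>j. \<bar>g j\<bar> \<le> B"
  shows "(\<lambda>n. prob {\<omega> \<in> space M. X \<omega> = int n} * g (int n)) sums expectation (\<lambda>\<omega>. g (X \<omega>))"
proof -
  have "(\<lambda>n. prob {\<omega> \<in> space M. nat (X \<omega>) = n} * g (int n)) sums expectation (\<lambda>\<omega>. g (int (nat (X \<omega>))))"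
    by (rule discrete_expectation_sums[where B = B]) (simp_all add: g)
  moreover have "prob {\<omega> \<in> space M. nat (X \<omega>) = n} = prob {\<omega> \<in> space M. X \<omega> = int n}" for n
    by (rule measure_eq_AE) (use nonneg in \<open>auto elim!: eventually_mono\<close>)
  moreover have "expectation (\<lambda>\<omega>. g (int (nat (X \<omega>)))) = expectation (\<lambda>\<omega>. g (X \<omega>))"
    by (rule integral_cong_AE) (use nonneg in \<open>auto elim!: eventually_mono\<close>)
  ultimately show ?thesis by simp
qed

text \<open>
  On a discrete space all sets are measurable, so the product formula for the full index set
  already contains the one for every subset of indices: put the whole space at the other indices.
\<close>
lemma (in prob_space) indep_vars_count_space_iff:
  assumes "finite I" and rv: "\<And>i. i \<in> I \<Longrightarrow> X i \<in> M \<rightarrow>\<^sub>M count_space UNIV"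
  shows "indep_vars (\<lambda>_. count_space UNIV) X I \<longleftrightarrow>
    (\<forall>A. prob {\<omega> \<in> space M. \<forall>i\<in>I. X i \<omega> \<in> A i} = (\<Prod>i\<in>I. prob {\<omega> \<in> space M. X i \<omega> \<in> A i}))"
proof (cases "I = {}")
  case True
  thus ?thesis by (simp add: indep_vars_def2 indep_sets_def prob_space)
next
  case False
  have "indep_vars (\<lambda>_. count_space UNIV) X I \<longleftrightarrow>
    (\<forall>A\<in>I \<rightarrow> UNIV. prob (\<Inter>i\<in>I. X i -` A i \<inter> space M) = (\<Prod>i\<in>I. prob (X i -` A i \<inter> space M)))"
    by (subst indep_vars_finite[where E = "\<lambda>_. UNIV"])
       (use assms False in \<open>auto simp: Int_stable_def intro: sigma_sets.Basic\<close>)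
  moreover have "(\<Inter>i\<in>I. X i -` A i \<inter> space M) = {\<omega> \<in> space M. \<forall>i\<in>I. X i \<omega> \<in> A i}" for A
    using False by auto
  moreover have "X i -` A i \<inter> space M = {\<omega> \<in> space M. X i \<omega> \<in> A i}" for A i
    by auto
  ultimately show ?thesis by simp
qed

section \<open>Increments of counting processes\<close>

lemma partition_points_nonneg:
  fixes \<tau> :: "nat \<Rightarrow> real"
  assumes "0 \<le> \<tau> 0" "\<And>i. i < n \<Longrightarrow> \<tau> i < \<tau> (Suc i)" "i \<le> n"
  shows "0 \<le> \<tau> i"
  using assms(3)
proof (induction i)
  case (Suc i)
  thus ?case using assms(2)[of i] by simp
qed (use assms in simp)

lemma counting_process_measurable:
  "counting_process M N \<Longrightarrow> 0 \<le> t \<Longrightarrow> N t \<in> M \<rightarrow>\<^sub>M count_space UNIV"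
  by (simp add: counting_process_def)

lemma increment_measurable:
  assumes "counting_process M N" "0 \<le> s" "0 \<le> t"
  shows "increment N s t \<in> M \<rightarrow>\<^sub>M count_space UNIV"
proof -
  have [measurable]: "N s \<in> M \<rightarrow>\<^sub>M count_space UNIV" "N t \<in> M \<rightarrow>\<^sub>M count_space UNIV"
    using assms by (auto simp: counting_process_measurable)
  show ?thesis unfolding increment_def by measurable
qed

lemma increment_nonneg:
  assumes "counting_process M N" "0 \<le> s" "s \<le> t"
  shows "AE \<omega> in M. 0 \<le> increment N s t \<omega>"
proof -
  have "AE \<omega> in M. \<forall>s t. 0 \<le> s \<and> s \<le> t \<longrightarrow> N s \<omega> \<le> N t \<omega>"
    using assms(1) by (simp add: counting_process_def)
  thus ?thesis
    by (rule eventually_mono) (use assms(2,3) in \<open>auto simp: increment_def\<close>)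
qed

text \<open>
  A random time change may stand still, so independence of increments is needed also for partitions
  with repeated points. At natural times it follows by writing each increment as the sum of the
  unit increments in its block, an empty sum for a repeated point: functions of disjoint blocks
  of independent variables are independent.
\<close>
lemma independent_increments_nat_times:
  assumes N: "counting_process M N" "independent_increments M N"
    and mono: "\<And>i. i < n \<Longrightarrow> v i \<le> v (Suc i)"
  shows "prob_space.indep_vars M (\<lambda>_. count_space UNIV)
    (\<lambda>i. increment N (real (v i)) (real (v (Suc i)))) {..<n}"
proof -
  interpret prob_space M using N(1) by (simp add: counting_process_def)
  define K where "K i = {v i..<v (Suc i)}" for i
  have le: "v i \<le> v j" if "i \<le> j" "j \<le> n" for i j
    using that
  proof (induction j rule: dec_induct)
    case (step m)
    thus ?case using mono[of m] by simp
  qed simp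
  have "indep_vars (\<lambda>_. count_space UNIV) (\<lambda>l. increment N (real l) (real (Suc l))) {..<v n}"
    using N(2)[unfolded independent_increments_def, rule_format, of real "v n"] by simp
  hence "indep_vars (\<lambda>j. PiM (K j) (\<lambda>_. count_space UNIV))
      (\<lambda>j \<omega>. restrict (\<lambda>l. increment N (real l) (real (Suc l)) \<omega>) (K j)) {..<n}"
  proof (rule indep_vars_restrict)
    show "K j \<subseteq> {..<v n}" if "j \<in> {..<n}" for j
      using le[of "Suc j" n] that by (auto simp: K_def)
    have "K i \<inter> K j = {}" if "i < j" "j < n" for i j
      using le[of "Suc i" j] that by (auto simp: K_def)
    thus "disjoint_family_on K {..<n}"
      unfolding disjoint_family_on_def by (metis Int_commute lessThan_iff linorder_neqE_nat)
  qed
  hence "indep_vars (\<lambda>_. count_space UNIV)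
      (\<lambda>j \<omega>. \<Sum>l\<in>K j. restrict (\<lambda>l. increment N (real l) (real (Suc l)) \<omega>) (K j) l) {..<n}"
    by (rule indep_vars_compose2[where Y = "\<lambda>j f. \<Sum>l\<in>K j. f l"])
       (simp add: K_def count_space_PiM_finite)
  also have "(\<lambda>j \<omega>. \<Sum>l\<in>K j. restrict (\<lambda>l. increment N (real l) (real (Suc l)) \<omega>) (K j) l)
      = (\<lambda>j \<omega>. \<Sum>l\<in>K j. int (N (real (Suc l)) \<omega>) - int (N (real l) \<omega>))"
    by (intro ext sum.cong) (auto simp: increment_def)
  finally have *: "indep_vars (\<lambda>_. count_space UNIV)
      (\<lambda>j \<omega>. \<Sum>l\<in>K j. int (N (real (Suc l)) \<omega>) - int (N (real l) \<omega>)) {..<n}" .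
  have "(\<Sum>l\<in>K j. int (N (real (Suc l)) \<omega>) - int (N (real l) \<omega>))
      = increment N (real (v j)) (real (v (Suc j))) \<omega>" if "j < n" for j \<omega>
    unfolding K_def increment_def
    by (rule sum_Suc_diff'[where f = "\<lambda>l. int (N (real l) \<omega>)"]) (rule mono[OF that])
  hence "indep_vars (\<lambda>_. count_space UNIV)
      (\<lambda>j \<omega>. \<Sum>l\<in>K j. int (N (real (Suc l)) \<omega>) - int (N (real l) \<omega>)) {..<n} \<longleftrightarrow> ?thesis"
    by (intro indep_vars_cong) auto
  with * show ?thesis by blast
qed

lemma mean_function_0: "mean_function rate 0 = 0"
  by (simp add: mean_function_def set_lebesgue_integral_def)

lemma mean_function_const: "0 \<le> t \<Longrightarrow> mean_function (\<lambda>_. c) t = c * t"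
  by (simp add: mean_function_def set_lebesgue_integral_def mult.commute)

text \<open>
  The definition prescribes only the laws of the single values \<open>N t\<close>. Since \<open>N t\<close> is the
  independent sum of \<open>N s\<close> and the increment, the increment must have the law whose convolution
  with the Poisson law of mean \<open>m s\<close> is the Poisson law of mean \<open>m t\<close>.
\<close>
lemma nonhomogeneous_poisson_process_increment:
  assumes N: "nonhomogeneous_poisson_process M N rate" and "0 \<le> s" "s \<le> t"
  shows "measure M {\<omega> \<in> space M. increment N s t \<omega> = int n}
    = poisson_mass (mean_function rate t - mean_function rate s) n"
proof -
  let ?m = "mean_function rate"
  have cp: "counting_process M N" and inc: "independent_increments M N"
    and N0: "AE \<omega> in M. N 0 \<omega> = 0"
    and law: "\<And>t n. 0 \<le> t \<Longrightarrow> measure M {\<omega> \<in> space M. N t \<omega> = n} = poisson_mass (?m t) n"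
    using N by (auto simp: nonhomogeneous_poisson_process_def poisson_mass_def)
  interpret prob_space M using cp by (simp add: counting_process_def)
  note [measurable] = counting_process_measurable[OF cp] increment_measurable[OF cp]
  have zero: "prob {\<omega> \<in> space M. increment N 0 u \<omega> = int k} = poisson_mass (?m u) k" if "0 \<le> u" for u k
  proof -
    have "prob {\<omega> \<in> space M. increment N 0 u \<omega> = int k} = prob {\<omega> \<in> space M. N u \<omega> = k}"
      by (rule measure_eq_AE)
         (use N0 that in \<open>auto elim!: eventually_mono simp: increment_def\<close>)
    thus ?thesis using law[OF that] by simp
  qed
  consider "s = t" | "s = 0" | "0 < s" "s < t" using assms by linarith
  thus ?thesis
  proof cases
    case 1
    thus ?thesis by (cases "n = 0") (auto simp: increment_def poisson_mass_def prob_space)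
  next
    case 2
    thus ?thesis using zero[of t] assms by (simp add: mean_function_0)
  next
    case 3
    (* the partition 0 < s < t, with values in the first and in the second interval prescribed *)
    define \<tau> where "\<tau> i = (if i = 0 then 0 else if i = 1 then s else t)" for i :: nat
    have "indep_vars (\<lambda>_. count_space UNIV) (\<lambda>i. increment N (\<tau> i) (\<tau> (Suc i))) {..<2}"
      using inc[unfolded independent_increments_def, rule_format, of \<tau> 2] 3
      by (simp add: \<tau>_def less_2_cases_iff)
    hence "prob {\<omega> \<in> space M. \<forall>i\<in>{..<2}. increment N (\<tau> i) (\<tau> (Suc i)) \<omega> \<in> (if i = 0 then {int j} else {int k})}
       = (\<Prod>i\<in>{..<2}. prob {\<omega> \<in> space M. increment N (\<tau> i) (\<tau> (Suc i)) \<omega> \<in> (if i = 0 then {int j} else {int k})})"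
      for j k :: nat
      using 3 by (subst (asm) indep_vars_count_space_iff) (auto intro!: increment_measurable[OF cp] simp: \<tau>_def)
    hence pair: "prob {\<omega> \<in> space M. increment N 0 s \<omega> = int j \<and> increment N s t \<omega> = int k}
       = poisson_mass (?m s) j * prob {\<omega> \<in> space M. increment N s t \<omega> = int k}" for j k
      using zero[of s] 3 by (simp add: \<tau>_def numeral_2_eq_2 lessThan_Suc conj_commute mult.commute)
    have "(\<Sum>i\<le>n. poisson_mass (?m s) i * prob {\<omega> \<in> space M. increment N s t \<omega> = int (n - i)})
        = poisson_mass (?m t) n" for n
    proof -
      have "(\<Sum>i\<le>n. poisson_mass (?m s) i * prob {\<omega> \<in> space M. increment N s t \<omega> = int (n - i)})
        = prob (\<Union>i\<in>{..n}. {\<omega> \<in> space M. increment N 0 s \<omega> = int i \<and> increment N s t \<omega> = int (n - i)})"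
        unfolding pair[symmetric]
        by (rule finite_measure_finite_Union[symmetric])
           (use 3 in \<open>auto simp: disjoint_family_on_def\<close>)
      also have "\<dots> = prob {\<omega> \<in> space M. increment N 0 t \<omega> = int n}"
      proof (rule measure_eq_AE)
        have "AE \<omega> in M. 0 \<le> increment N 0 s \<omega>" "AE \<omega> in M. 0 \<le> increment N s t \<omega>"
          using 3 by (auto intro!: increment_nonneg[OF cp])
        thus "AE \<omega> in M. (\<omega> \<in> (\<Union>i\<in>{..n}. {\<omega> \<in> space M. increment N 0 s \<omega> = int i \<and> increment N s t \<omega> = int (n - i)}))
            \<longleftrightarrow> \<omega> \<in> {\<omega> \<in> space M. increment N 0 t \<omega> = int n}"
        proof eventually_elim
          case (elim \<omega>)
          have add: "increment N 0 t \<omega> = increment N 0 s \<omega> + increment N s t \<omega>"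
            by (simp add: increment_def)
          show ?case
          proof
            assume r: "\<omega> \<in> {\<omega> \<in> space M. increment N 0 t \<omega> = int n}"
            have "increment N 0 s \<omega> = int (nat (increment N 0 s \<omega>))" "nat (increment N 0 s \<omega>) \<le> n"
              "increment N s t \<omega> = int (n - nat (increment N 0 s \<omega>))"
              using r elim add by auto
            thus "\<omega> \<in> (\<Union>i\<in>{..n}. {\<omega> \<in> space M. increment N 0 s \<omega> = int i \<and> increment N s t \<omega> = int (n - i)})"
              using r by blast
          qed (auto simp: add)
        qed
      qed (use 3 in auto)
      finally show ?thesis using zero[of t] 3 by simp
    qed
    moreover have "(\<Sum>i\<le>n. poisson_mass (?m s) i * poisson_mass (?m t - ?m s) (n - i)) = poisson_mass (?m t) n" for n
      by (simp add: poisson_mass_convolution)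
    ultimately show ?thesis
      using convolution_cancel[of "poisson_mass (?m s)"
          "\<lambda>k. prob {\<omega> \<in> space M. increment N s t \<omega> = int k}" "poisson_mass (?m t - ?m s)" n]
      by (simp add: poisson_mass_def[of _ 0])
  qed
qed

section \<open>Time change of a Poisson process\<close>

locale time_changed_poisson = prob_space M for M :: "'a measure" +
  fixes N1 N2 :: "real \<Rightarrow> 'a \<Rightarrow> nat" and rate :: "real \<Rightarrow> real" and \<nu> :: real
  assumes N1: "poisson_process M N1 \<nu>"
    and N2: "nonhomogeneous_poisson_process M N2 rate"
    and indep: "independent_processes M N1 N2"
begin

definition Nhat :: "real \<Rightarrow> 'a \<Rightarrow> nat" where
  "Nhat t \<omega> = N1 (real (N2 t \<omega>)) \<omega>"

text \<open>
  The transition kernel of \<open>N1\<close> at integer times: increments of \<open>N1\<close> are stationary, so their laws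
  can all be read off from increments that start at time \<open>0\<close>.
\<close>
definition jump_prob :: "nat \<Rightarrow> int set \<Rightarrow> real" where
  "jump_prob d A = prob {\<omega> \<in> space M. increment N1 0 (real d) \<omega> \<in> A}"

lemma N1_counting: "counting_process M N1" and N2_counting: "counting_process M N2"
  and N1_0: "AE \<omega> in M. N1 0 \<omega> = 0" and N2_0: "AE \<omega> in M. N2 0 \<omega> = 0"
  and N1_indep: "independent_increments M N1" and N2_indep: "independent_increments M N2"
  using N1 N2 by (auto simp: poisson_process_def nonhomogeneous_poisson_process_def)

lemmas [measurable] = counting_process_measurable[OF N1_counting] counting_process_measurable[OF N2_counting]
  increment_measurable[OF N1_counting] increment_measurable[OF N2_counting]

lemma N1_increment_mass:
  assumes "0 \<le> s" "s \<le> t"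
  shows "prob {\<omega> \<in> space M. increment N1 s t \<omega> = int n} = poisson_mass (\<nu> * (t - s)) n"
  using nonhomogeneous_poisson_process_increment[OF N1[unfolded poisson_process_def] assms, of n] assms
  by (simp add: mean_function_const right_diff_distrib)

lemma jump_prob_singleton: "jump_prob d {int n} = poisson_mass (\<nu> * real d) n"
  by (simp add: jump_prob_def N1_increment_mass)

lemma jump_prob_bounded: "\<bar>jump_prob d A\<bar> \<le> 1"
  by (simp add: jump_prob_def)

lemma N1_increment_prob:
  assumes "a \<le> b"
  shows "prob {\<omega> \<in> space M. increment N1 (real a) (real b) \<omega> \<in> A} = jump_prob (b - a) A"
proof -
  (* the probability of A is a series that involves only the length of the time interval *)
  have *: "(\<lambda>n. poisson_mass (\<nu> * real (l - k)) n * indicator A (int n)) sums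
      prob {\<omega> \<in> space M. increment N1 (real k) (real l) \<omega> \<in> A}" if "k \<le> l" for k l
  proof -
    have "(\<lambda>n. prob {\<omega> \<in> space M. increment N1 (real k) (real l) \<omega> = int n} * indicator A (int n)) sums
      expectation (\<lambda>\<omega>. indicator A (increment N1 (real k) (real l) \<omega>))"
      by (rule nonneg_int_expectation_sums[where B = 1])
         (use that in \<open>auto intro!: increment_nonneg[OF N1_counting] split: split_indicator\<close>)
    also have "expectation (\<lambda>\<omega>. indicator A (increment N1 (real k) (real l) \<omega>))
       = expectation (indicator {\<omega> \<in> space M. increment N1 (real k) (real l) \<omega> \<in> A})"
      by (rule Bochner_Integration.integral_cong) (auto split: split_indicator)
    also have "\<dots> = prob {\<omega> \<in> space M. increment N1 (real k) (real l) \<omega> \<in> A}"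
      by simp
    finally show ?thesis
      using that by (simp add: N1_increment_mass of_nat_diff)
  qed
  show ?thesis
    using sums_unique2[OF *[OF assms]] *[of 0 "b - a"] by (simp add: jump_prob_def)
qed

lemma N1_increments_prob:
  assumes "\<And>i. i < n \<Longrightarrow> v i \<le> v (Suc i)"
  shows "prob {\<omega> \<in> space M. \<forall>i<n. increment N1 (real (v i)) (real (v (Suc i))) \<omega> \<in> A i}
    = (\<Prod>i<n. jump_prob (v (Suc i) - v i) (A i))"
proof -
  have "indep_vars (\<lambda>_. count_space UNIV) (\<lambda>i. increment N1 (real (v i)) (real (v (Suc i)))) {..<n}"
    by (rule independent_increments_nat_times[OF N1_counting N1_indep]) (rule assms)
  hence "prob {\<omega> \<in> space M. \<forall>i<n. increment N1 (real (v i)) (real (v (Suc i))) \<omega> \<in> A i}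
    = (\<Prod>i<n. prob {\<omega> \<in> space M. increment N1 (real (v i)) (real (v (Suc i))) \<omega> \<in> A i})"
    by (subst (asm) indep_vars_count_space_iff) (auto simp: Ball_def)
  also have "\<dots> = (\<Prod>i<n. jump_prob (v (Suc i) - v i) (A i))"
    by (intro prod.cong) (auto simp: N1_increment_prob assms)
  finally show ?thesis .
qed

text \<open>
  Independence of the two whole processes, brought down to the finitely many coordinates that
  matter for one partition.
\<close>
lemma prob_N2_values_N1_increments:
  assumes \<tau>: "\<And>i. i \<le> n \<Longrightarrow> 0 \<le> \<tau> i"
  shows "prob {\<omega> \<in> space M. (\<forall>i\<le>n. N2 (\<tau> i) \<omega> = v i)
        \<and> (\<forall>i<n. increment N1 (real (v i)) (real (v (Suc i))) \<omega> \<in> A i)}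
    = prob {\<omega> \<in> space M. \<forall>i\<le>n. N2 (\<tau> i) \<omega> = v i}
      * prob {\<omega> \<in> space M. \<forall>i<n. increment N1 (real (v i)) (real (v (Suc i))) \<omega> \<in> A i}"
proof -
  let ?P = "PiM {0..} (\<lambda>_. count_space UNIV) :: (real \<Rightarrow> nat) measure"
  have comp [measurable]: "(\<lambda>f. f t) \<in> ?P \<rightarrow>\<^sub>M count_space UNIV" if "0 \<le> t" for t
    using that by (intro measurable_component_singleton) auto
  define X1 where "X1 = {f \<in> space ?P. \<forall>i<n. int (f (real (v (Suc i)))) - int (f (real (v i))) \<in> A i}"
  define X2 where "X2 = {f \<in> space ?P. \<forall>i\<in>{..n}. f (\<tau> i) = v i}"
  have X1: "X1 \<in> sets ?P" unfolding X1_def by measurable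
  have [measurable]: "(\<lambda>f. f (\<tau> i)) \<in> ?P \<rightarrow>\<^sub>M count_space UNIV" if "i \<in> {..n}" for i
    using that by (intro comp \<tau>) auto
  have X2: "X2 \<in> sets ?P" unfolding X2_def by measurable
  have r: "(\<lambda>t\<in>{0..}. N t \<omega>) \<in> space ?P" for N :: "real \<Rightarrow> 'a \<Rightarrow> nat" and \<omega>
    by (auto simp: space_PiM)
  have e1: "((\<lambda>\<omega>. \<lambda>t\<in>{0..}. N1 t \<omega>) -` X1 \<inter> space M)
      = {\<omega> \<in> space M. \<forall>i<n. increment N1 (real (v i)) (real (v (Suc i))) \<omega> \<in> A i}"
    using r by (auto simp: X1_def increment_def)
  have e2: "((\<lambda>\<omega>. \<lambda>t\<in>{0..}. N2 t \<omega>) -` X2 \<inter> space M) = {\<omega> \<in> space M. \<forall>i\<le>n. N2 (\<tau> i) \<omega> = v i}"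
    using r \<tau> by (auto simp: X2_def)
  have e12: "((\<lambda>\<omega>. (\<lambda>t\<in>{0..}. N1 t \<omega>, \<lambda>t\<in>{0..}. N2 t \<omega>)) -` (X1 \<times> X2) \<inter> space M)
      = {\<omega> \<in> space M. (\<forall>i\<le>n. N2 (\<tau> i) \<omega> = v i)
        \<and> (\<forall>i<n. increment N1 (real (v i)) (real (v (Suc i))) \<omega> \<in> A i)}"
    using e1 e2 by blast
  show ?thesis
    using indep_varD[OF indep[unfolded independent_processes_def] X1 X2]
    unfolding e1 e2 e12 by (simp add: mult.commute)
qed

text \<open>
  Given the values of \<open>N2\<close> at the partition points, the increments of \<open>Nhat\<close> are increments of \<open>N1\<close>
  between fixed integer times, hence independent with laws given by \<^const>\<open>jump_prob\<close>. These laws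
  depend on \<open>N2\<close> only through its own increments, which are independent, so the expectation of the
  product splits.
\<close>
lemma Nhat_increments_prob:
  assumes "0 \<le> \<tau> 0" and mono: "\<And>i. i < n \<Longrightarrow> \<tau> i < \<tau> (Suc i)"
  shows "prob {\<omega> \<in> space M. \<forall>i<n. increment Nhat (\<tau> i) (\<tau> (Suc i)) \<omega> \<in> A i}
    = (\<Prod>i<n. expectation (\<lambda>\<omega>. jump_prob (nat (increment N2 (\<tau> i) (\<tau> (Suc i)) \<omega>)) (A i)))"
proof -
  have \<tau>: "0 \<le> \<tau> i" if "i \<le> n" for i
    using partition_points_nonneg[OF assms(1) mono that] .
  (* V lists the values of N2 at the partition points; lists of naturals form a countable type *)
  define V where "V \<omega> = map (\<lambda>i. N2 (\<tau> i) \<omega>) [0..<Suc n]" for \<omega>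
  define E where "E v = {\<omega> \<in> space M. \<forall>i<n. increment N1 (real (v ! i)) (real (v ! Suc i)) \<omega> \<in> A i}" for v
  have V_nth: "V \<omega> ! i = N2 (\<tau> i) \<omega>" if "i \<le> n" for \<omega> i
    using that by (simp add: V_def del: upt_Suc)
  have V_eq: "V \<omega> = v \<longleftrightarrow> length v = Suc n \<and> (\<forall>i\<le>n. N2 (\<tau> i) \<omega> = v ! i)" for \<omega> v
    by (auto simp: V_def list_eq_iff_nth_eq less_Suc_eq_le simp del: upt_Suc)
  have [measurable]: "N2 (\<tau> i) \<in> M \<rightarrow>\<^sub>M count_space UNIV" if "i \<in> {..n}" for i
    using that \<tau> by simp
  have V: "V \<in> M \<rightarrow>\<^sub>M count_space UNIV"
  proof -
    have "{\<omega> \<in> space M. \<forall>i\<in>{..n}. N2 (\<tau> i) \<omega> = v ! i} \<in> events" for v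
      by measurable
    moreover have "V -` {v} \<inter> space M
        = (if length v = Suc n then {\<omega> \<in> space M. \<forall>i\<in>{..n}. N2 (\<tau> i) \<omega> = v ! i} else {})" for v
      using V_eq by auto
    ultimately show ?thesis
      by (subst measurable_count_space_eq2_countable) auto
  qed
  have E: "E v \<in> events" for v
    unfolding E_def by measurable
  have indep_V: "prob {\<omega> \<in> space M. V \<omega> = v \<and> \<omega> \<in> E v} = prob {\<omega> \<in> space M. V \<omega> = v} * prob (E v)" for v
  proof (cases "length v = Suc n")
    case True
    have "prob {\<omega> \<in> space M. V \<omega> = v \<and> \<omega> \<in> E v} = prob {\<omega> \<in> space M. (\<forall>i\<le>n. N2 (\<tau> i) \<omega> = v ! i)
        \<and> (\<forall>i<n. increment N1 (real (v ! i)) (real (v ! Suc i)) \<omega> \<in> A i)}"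
      by (rule arg_cong[where f = prob]) (auto simp: V_eq E_def True)
    thus ?thesis
      using prob_N2_values_N1_increments[of n \<tau> "\<lambda>i. v ! i" A] \<tau> by (simp add: V_eq E_def True)
  qed (simp add: V_eq)
  have "prob {\<omega> \<in> space M. \<forall>i<n. increment Nhat (\<tau> i) (\<tau> (Suc i)) \<omega> \<in> A i}
      = prob {\<omega> \<in> space M. \<omega> \<in> E (V \<omega>)}"
    by (rule arg_cong[where f = prob]) (auto simp: E_def V_nth increment_def Nhat_def)
  also have "\<dots> = expectation (\<lambda>\<omega>. prob (E (V \<omega>)))"
    by (rule prob_random_event[OF V E indep_V])
  also have "\<dots> = expectation (\<lambda>\<omega>. \<Prod>i<n. jump_prob (nat (increment N2 (\<tau> i) (\<tau> (Suc i)) \<omega>)) (A i))"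
  proof (rule integral_cong_AE)
    show "(\<lambda>\<omega>. prob (E (V \<omega>))) \<in> borel_measurable M"
      by (rule measurable_compose[OF V]) simp
    show "(\<lambda>\<omega>. \<Prod>i<n. jump_prob (nat (increment N2 (\<tau> i) (\<tau> (Suc i)) \<omega>)) (A i)) \<in> borel_measurable M"
    proof (rule borel_measurable_prod)
      fix i assume "i \<in> {..<n}"
      hence [measurable]: "increment N2 (\<tau> i) (\<tau> (Suc i)) \<in> M \<rightarrow>\<^sub>M count_space UNIV"
        using \<tau> by simp
      show "(\<lambda>\<omega>. jump_prob (nat (increment N2 (\<tau> i) (\<tau> (Suc i)) \<omega>)) (A i)) \<in> borel_measurable M"
        by measurable
    qed
    have "AE \<omega> in M. \<forall>s t. 0 \<le> s \<and> s \<le> t \<longrightarrow> N2 s \<omega> \<le> N2 t \<omega>"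
      using N2_counting by (simp add: counting_process_def)
    thus "AE \<omega> in M. prob (E (V \<omega>)) = (\<Prod>i<n. jump_prob (nat (increment N2 (\<tau> i) (\<tau> (Suc i)) \<omega>)) (A i))"
    proof (rule eventually_mono)
      fix \<omega> assume \<omega>: "\<forall>s t. 0 \<le> s \<and> s \<le> t \<longrightarrow> N2 s \<omega> \<le> N2 t \<omega>"
      have "V \<omega> ! i \<le> V \<omega> ! Suc i" if "i < n" for i
        using \<omega> \<tau>[of i] mono[of i] that by (simp add: V_nth)
      hence "prob (E (V \<omega>)) = (\<Prod>i<n. jump_prob (V \<omega> ! Suc i - V \<omega> ! i) (A i))"
        unfolding E_def by (rule N1_increments_prob)
      also have "\<dots> = (\<Prod>i<n. jump_prob (nat (increment N2 (\<tau> i) (\<tau> (Suc i)) \<omega>)) (A i))"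
        by (intro prod.cong) (auto simp: V_nth increment_def nat_minus_as_int)
      finally show "prob (E (V \<omega>)) = \<dots>" .
    qed
  qed
  also have "\<dots> = (\<Prod>i<n. expectation (\<lambda>\<omega>. jump_prob (nat (increment N2 (\<tau> i) (\<tau> (Suc i)) \<omega>)) (A i)))"
  proof (rule indep_vars_lebesgue_integral)
    show iv: "indep_vars (\<lambda>_. borel) (\<lambda>i \<omega>. jump_prob (nat (increment N2 (\<tau> i) (\<tau> (Suc i)) \<omega>)) (A i)) {..<n}"
      by (rule indep_vars_compose2[where Y = "\<lambda>i d. jump_prob (nat d) (A i)"])
         (use N2_indep assms in \<open>auto simp: independent_increments_def\<close>)
    show "integrable M (\<lambda>\<omega>. jump_prob (nat (increment N2 (\<tau> i) (\<tau> (Suc i)) \<omega>)) (A i))" if "i \<in> {..<n}" for i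
      using iv that jump_prob_bounded
      by (intro integrable_const_bound[where B = 1]) (auto simp: indep_vars_def)
  qed simp
  finally show ?thesis .
qed

lemma Nhat_increment_prob:
  assumes "0 \<le> s" "s < t"
  shows "prob {\<omega> \<in> space M. increment Nhat s t \<omega> \<in> A}
    = expectation (\<lambda>\<omega>. jump_prob (nat (increment N2 s t \<omega>)) A)"
  using Nhat_increments_prob[of "\<lambda>i. if i = 0 then s else t" 1 "\<lambda>_. A"] assms by simp

lemma Nhat_counting: "counting_process M Nhat"
proof -
  have "Nhat t \<in> M \<rightarrow>\<^sub>M count_space UNIV" if "0 \<le> t" for t
    unfolding Nhat_def
    by (rule measurable_compose_countable) (use that in auto)
  moreover have "AE \<omega> in M. \<forall>s t. 0 \<le> s \<and> s \<le> t \<longrightarrow> N1 s \<omega> \<le> N1 t \<omega>"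
    "AE \<omega> in M. \<forall>s t. 0 \<le> s \<and> s \<le> t \<longrightarrow> N2 s \<omega> \<le> N2 t \<omega>"
    using N1_counting N2_counting by (simp_all add: counting_process_def)
  hence "AE \<omega> in M. \<forall>s t. 0 \<le> s \<and> s \<le> t \<longrightarrow> Nhat s \<omega> \<le> Nhat t \<omega>"
    by eventually_elim (auto simp: Nhat_def)
  ultimately show ?thesis
    by (simp add: counting_process_def prob_space_axioms)
qed

lemma Nhat_0: "AE \<omega> in M. Nhat 0 \<omega> = 0"
  using N1_0 N2_0 by eventually_elim (simp add: Nhat_def)

text \<open>
  The one-step case of the product formula identifies each factor as the probability of a
  single increment event.
\<close>
lemma Nhat_independent_increments: "independent_increments M Nhat"
  unfolding independent_increments_def
proof (intro allI impI)
  fix n and \<tau> :: "nat \<Rightarrow> real"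
  assume \<tau>: "0 \<le> \<tau> 0 \<and> (\<forall>i<n. \<tau> i < \<tau> (Suc i))"
  have \<tau>_nonneg: "0 \<le> \<tau> i" if "i \<le> n" for i
    using partition_points_nonneg[of \<tau> n i] \<tau> that by blast
  show "indep_vars (\<lambda>_. count_space UNIV) (\<lambda>i. increment Nhat (\<tau> i) (\<tau> (Suc i))) {..<n}"
  proof (subst indep_vars_count_space_iff)
    show "\<forall>A. prob {\<omega> \<in> space M. \<forall>i\<in>{..<n}. increment Nhat (\<tau> i) (\<tau> (Suc i)) \<omega> \<in> A i}
       = (\<Prod>i<n. prob {\<omega> \<in> space M. increment Nhat (\<tau> i) (\<tau> (Suc i)) \<omega> \<in> A i})"
      using \<tau> \<tau>_nonneg by (simp add: Nhat_increments_prob Nhat_increment_prob Ball_def)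
  qed (use \<tau>_nonneg in \<open>auto intro!: increment_measurable[OF Nhat_counting]\<close>)
qed

text \<open>
  Averaging the Poisson transition probabilities of \<open>N1\<close> over the Poisson increment of \<open>N2\<close>.
\<close>
lemma Nhat_increment_mass:
  assumes "0 \<le> s" "s < t"
  shows "prob {\<omega> \<in> space M. increment Nhat s t \<omega> = int n}
    = bell_touchard_mass ((mean_function rate t - mean_function rate s) * exp (- \<nu>)) \<nu> n"
proof -
  have "(\<lambda>j. prob {\<omega> \<in> space M. increment N2 s t \<omega> = int j} * jump_prob (nat (int j)) {int n}) sums
      expectation (\<lambda>\<omega>. jump_prob (nat (increment N2 s t \<omega>)) {int n})"
    by (rule nonneg_int_expectation_sums[where B = 1])
       (use assms in \<open>auto intro!: increment_nonneg[OF N2_counting] jump_prob_bounded\<close>)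
  hence "(\<lambda>j. poisson_mass (mean_function rate t - mean_function rate s) j * poisson_mass (\<nu> * real j) n) sums
      prob {\<omega> \<in> space M. increment Nhat s t \<omega> = int n}"
    using assms Nhat_increment_prob[OF assms, of "{int n}"]
    by (simp add: jump_prob_singleton nonhomogeneous_poisson_process_increment[OF N2])
  thus ?thesis
    using poisson_mixture_sums_bell_touchard sums_unique2 by blast
qed

lemma Nhat_mass:
  assumes "0 < t"
  shows "prob {\<omega> \<in> space M. Nhat t \<omega> = n} = bell_touchard_mass (mean_function rate t * exp (- \<nu>)) \<nu> n"
proof -
  note [measurable] = counting_process_measurable[OF Nhat_counting] increment_measurable[OF Nhat_counting]
  have "prob {\<omega> \<in> space M. Nhat t \<omega> = n} = prob {\<omega> \<in> space M. increment Nhat 0 t \<omega> = int n}"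
    by (rule measure_eq_AE) (use Nhat_0 assms in \<open>auto elim!: eventually_mono simp: increment_def\<close>)
  thus ?thesis
    using Nhat_increment_mass[of 0 t n] assms by (simp add: mean_function_0)
qed

end

section \<open>Infinitesimal rates\<close>

text \<open>
  The one-sided fundamental theorem of calculus: right-continuity of the rate makes the mean number
  of events in \<open>(t, t + s]\<close> equal to \<open>rate t * s + o(s)\<close>.
\<close>
lemma mean_function_right_derivative:
  assumes int: "\<And>t. 0 < t \<Longrightarrow> set_integrable lborel {0<..t} rate"
    and "0 < t" and cont: "continuous (at_right t) rate"
  shows "((\<lambda>s. mean_function rate (t + s) - mean_function rate t) has_real_derivative rate t) (at_right 0)"
proof -
  (* the maximum keeps the enclosing interval one of those with positive right end *)
  have int': "set_integrable lborel {t..u} rate" for u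
    by (rule set_integrable_subset[OF int[of "max t u"]]) (use \<open>0 < t\<close> in auto)
  have diff: "mean_function rate u - mean_function rate t = integral {t..u} rate" if "t \<le> u" for u
  proof -
    have "(LINT s:{0<..t} \<union> {t<..u}|lborel. rate s) = (LINT s:{0<..t}|lborel. rate s) + (LINT s:{t<..u}|lborel. rate s)"
      by (rule set_integral_Un) (use \<open>0 < t\<close> in \<open>auto intro: int set_integrable_subset[OF int'[of u]]\<close>)
    also have "{0<..t} \<union> {t<..u} = {0<..u}" using \<open>0 < t\<close> that by auto
    also have "(LINT s:{t<..u}|lborel. rate s) = integral {t<..u} rate"
      by (rule set_borel_integral_eq_integral) (auto intro: set_integrable_subset[OF int'[of u]])
    also have "\<dots> = integral {t..u} rate"
      by (rule integral_spike_set) (rule negligible_subset[of "{t}"]; force)+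
    finally show ?thesis by (simp add: mean_function_def)
  qed
  have "((\<lambda>u. integral {t..u} rate) has_vector_derivative rate t) (at t within ({t..t + 1} - {}))"
  proof (rule integral_has_vector_derivative_continuous_at)
    show "rate integrable_on {t..t + 1}"
      by (rule set_borel_integral_eq_integral(1)[OF int'])
    have "at t within {t..t + 1} = at_right t"
      by (simp add: at_within_Icc_at_right)
    thus "continuous (at t within ({t..t + 1} - {})) rate" using cont by simp
  qed auto
  hence "((\<lambda>u. integral {t..u} rate) has_real_derivative rate t) (at t within {t..t + 1})"
    by (simp add: has_real_derivative_iff_has_vector_derivative)
  hence "((\<lambda>u. mean_function rate u - mean_function rate t) has_real_derivative rate t)
      (at t within {t..t + 1})"
    by (rule has_field_derivative_transform_within[where d = 1]) (auto simp: diff)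
  hence "((\<lambda>u. mean_function rate u - mean_function rate t) has_real_derivative rate t) (at_right t)"
    by (simp add: at_within_Icc_at_right)
  moreover have "(+) t ` {0<..} = {t<..}"
    by (auto simp: image_iff intro!: bexI[of _ "_ - t"])
  ultimately show ?thesis
    using DERIV_at_within_shift[of "\<lambda>u. mean_function rate u - mean_function rate t" "rate t" t 0 "{0<..}"]
    by simp
qed

lemma smallo_right_derivative:
  assumes "(f has_real_derivative D) (at_right 0)" "f 0 = 0"
  shows "(\<lambda>s. f s - D * s) \<in> o[at_right 0](\<lambda>s. s)"
proof -
  have "((\<lambda>s. f s / s) \<longlongrightarrow> D) (at_right 0)"
    using assms by (simp add: has_field_derivative_iff)
  hence "((\<lambda>s. f s / s - D) \<longlongrightarrow> 0) (at_right 0)"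
    by (simp add: LIM_zero_iff)
  moreover have "eventually (\<lambda>s. f s / s - D = (f s - D * s) / s) (at_right 0)"
    by (auto simp: eventually_at_filter field_simps)
  ultimately have "((\<lambda>s. (f s - D * s) / s) \<longlongrightarrow> 0) (at_right 0)"
    by (rule Lim_transform_eventually)
  thus ?thesis
    by (intro smalloI_tendsto) (auto simp: eventually_at_filter)
qed

theorem theorem3p5:
  fixes M :: "'a measure"
    and N1 N2 :: "real \<Rightarrow> 'a \<Rightarrow> nat"
    and rate :: "real \<Rightarrow> real"
    and \<nu> :: real
  defines "Nhat \<equiv> \<lambda>t \<omega>. N1 (real (N2 t \<omega>)) \<omega>"
  assumes "\<nu> > 0"
    and "poisson_process M N1 \<nu>"
    and "nonhomogeneous_poisson_process M N2 rate"
    and "\<forall>t>0. continuous (at_right t) rate"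
    and "independent_processes M N1 N2"
  shows "nonhomogeneous_bell_touchard_process M Nhat (\<lambda>t. rate t * exp (- \<nu>)) \<nu>
    \<and> (\<forall>t>0. \<forall>n. measure M {\<omega> \<in> space M. Nhat t \<omega> = n} =
          bell_touchard_mass (mean_function rate t * exp (- \<nu>)) \<nu> n)"
proof -
  note N2 = \<open>nonhomogeneous_poisson_process M N2 rate\<close>
  interpret prob_space M
    using N2 by (simp add: nonhomogeneous_poisson_process_def counting_process_def)
  interpret T: time_changed_poisson M N1 N2 rate \<nu>
    by (unfold_locales; fact)
  have Nhat: "Nhat = T.Nhat" by (intro ext) (simp add: Nhat_def T.Nhat_def)
  have rate_nonneg: "\<forall>t>0. 0 \<le> rate t" and int: "\<And>t. 0 < t \<Longrightarrow> set_integrable lborel {0<..t} rate"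
    using N2 by (auto simp: nonhomogeneous_poisson_process_def)
  have rate: "(\<lambda>s. prob {\<omega> \<in> space M. increment Nhat t (t + s) \<omega> = int k}
        - rate t * exp (- \<nu>) * s * \<nu> ^ k / fact k) \<in> o[at_right 0](\<lambda>s. s)"
    if "k \<ge> 1" "t > 0" for k t
  proof -
    (* a s is the Bell-Touchard parameter of the increment over (t, t + s]; the chain rule at s = 0
       gives the rate *)
    define a where "a s = (mean_function rate (t + s) - mean_function rate t) * exp (- \<nu>)" for s
    have a0: "a 0 = 0" by (simp add: a_def)
    have a': "(a has_real_derivative rate t * exp (- \<nu>)) (at_right 0)"
      unfolding a_def using assms that
      by (intro DERIV_cmult_right mean_function_right_derivative int) auto
    have b': "((\<lambda>x. bell_touchard_mass x \<nu> k) has_real_derivative \<nu> ^ k / fact k) (at (a 0))"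
      using bell_touchard_mass_deriv_0[OF that(1)] by (simp add: a0)
    have "bell_touchard_mass 0 \<nu> k = 0"
      using that by (cases k) (simp_all add: bell_touchard_mass_def sum.atMost_Suc_shift)
    hence "(\<lambda>s. bell_touchard_mass (a s) \<nu> k - \<nu> ^ k / fact k * (rate t * exp (- \<nu>)) * s) \<in> o[at_right 0](\<lambda>s. s)"
      by (intro smallo_right_derivative DERIV_chain2[OF b' a']) (simp add: a0)
    also have "?this \<longleftrightarrow> ?thesis"
    proof (rule landau_o.small.in_cong)
      have "\<forall>\<^sub>F s in at_right (0::real). 0 < s" by (simp add: eventually_at_right_less)
      thus "\<forall>\<^sub>F s in at_right 0. bell_touchard_mass (a s) \<nu> k - \<nu> ^ k / fact k * (rate t * exp (- \<nu>)) * s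
          = prob {\<omega> \<in> space M. increment Nhat t (t + s) \<omega> = int k} - rate t * exp (- \<nu>) * s * \<nu> ^ k / fact k"
        by eventually_elim (use that in \<open>simp add: Nhat T.Nhat_increment_mass a_def\<close>)
    qed
    finally show ?thesis .
  qed
  show ?thesis
    using T.Nhat_counting T.Nhat_0 T.Nhat_independent_increments T.Nhat_mass rate rate_nonneg
    by (simp add: nonhomogeneous_bell_touchard_process_def Nhat)
qed

end
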